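(* Let $(A,m)$ be a local total ring of quotients, let $f: A\to B$ and $g:A\to C$ be two ring homomorphisms, and let $J$ be a nonzero proper ideal of $B$ and $J'$ a nonzero proper ideal of $C$ such that $f^{-1}(J)=g^{-1}(J')$ and $J\times J'\subseteq \mathrm{Jac}(B\times C)$. Assume that $f$ is injective, $J^2=0$ and $J'^2=0$. Then $A\bowtie^{f,g}(J,J')$ is a local total ring of quotients. In particular, $A\bowtie^{f,g}(J,J')$ is a Prüfer ring.
   Context: All rings are commutative with identity. A local ring is a ring with a unique maximal ideal (not assumed Noetherian); $(A,m)$ means $A$ is local with maximal ideal $m$. $\mathrm{Jac}(R)$ denotes the Jacobson radical of a ring $R$. A ring is a total ring of quotients if each of its elements is either invertible or a zero-divisor. Bi-amalgamation: for ring homomorphisms $f:A\to B$, $g:A\to C$ and ideals $J\subseteq B$, $J'\subseteq C$ with $f^{-1}(J)=g^{-1}(J')$, the bi-amalgamation of $A$ with $(B,C)$ along $(J,J')$ with respect to $(f,g)$ is the subring of $B\times C$ $$A\bowtie^{f,g}(J,J'):=\{(f(a)+j,\,g(a)+j') : a\in A,\ (j,j')\in J\times J'\}.$$ A ring $R$ is Prüfer if every finitely generated regular ideal of $R$ (i.e. finitely generated ideal containing a non-zero-divisor) is invertible (as a fractional ideal in the total ring of quotients of $R$). *)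

theory Defs
  imports "HOL-Algebra.Algebra"
begin

text \<open>Zero counts as a zero-divisor of every nonzero ring.\<close>

definition zero_divisor :: "('a, 'k) ring_scheme \<Rightarrow> 'a \<Rightarrow> bool" where
  "zero_divisor R a \<longleftrightarrow>
     a \<in> carrier R \<and> (\<exists>x \<in> carrier R. x \<noteq> \<zero>\<^bsub>R\<^esub> \<and> a \<otimes>\<^bsub>R\<^esub> x = \<zero>\<^bsub>R\<^esub>)"

definition regular_elements :: "('a, 'k) ring_scheme \<Rightarrow> 'a set" where
  "regular_elements R = {a \<in> carrier R. \<not> zero_divisor R a}"

definition is_total_ring_of_quotients :: "('a, 'k) ring_scheme \<Rightarrow> bool" where
  "is_total_ring_of_quotients R \<longleftrightarrow>
     cring R \<and> (\<forall>a \<in> carrier R. a \<in> Units R \<or> zero_divisor R a)"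

definition local_ring :: "('a, 'k) ring_scheme \<Rightarrow> bool" where
  "local_ring R \<longleftrightarrow> cring R \<and> (\<exists>!M. maximalideal M R)"

definition Jac :: "('a, 'k) ring_scheme \<Rightarrow> 'a set" where
  "Jac R = {x \<in> carrier R. \<forall>M. maximalideal M R \<longrightarrow> x \<in> M}"

definition bi_amalgamation ::
  "('a, 'k) ring_scheme \<Rightarrow> ('b, 'l) ring_scheme \<Rightarrow> ('c, 'n) ring_scheme \<Rightarrow>
   ('a \<Rightarrow> 'b) \<Rightarrow> ('a \<Rightarrow> 'c) \<Rightarrow> 'b set \<Rightarrow> 'c set \<Rightarrow> ('b \<times> 'c) ring" where
  "bi_amalgamation A B C f g J J' =
     (RDirProd B C)
       \<lparr>carrier := {(f a \<oplus>\<^bsub>B\<^esub> j, g a \<oplus>\<^bsub>C\<^esub> j') | a j j'. a \<in> carrier A \<and> j \<in> J \<and> j' \<in> J'}\<rparr>"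

text \<open>The total ring of quotients of \<open>R\<close> is the localization of \<open>R\<close> at its regular elements.
  As all denominators are regular, \<open>a/s = b/t\<close> amounts to \<open>a t = b s\<close>.\<close>

definition fraction_rel :: "('a, 'k) ring_scheme \<Rightarrow> (('a \<times> 'a) \<times> ('a \<times> 'a)) set" where
  "fraction_rel R =
     {((a, s), (b, t)) | a s b t.
        a \<in> carrier R \<and> s \<in> regular_elements R \<and> b \<in> carrier R \<and> t \<in> regular_elements R \<and>
        a \<otimes>\<^bsub>R\<^esub> t = b \<otimes>\<^bsub>R\<^esub> s}"

definition fraction :: "('a, 'k) ring_scheme \<Rightarrow> 'a \<Rightarrow> 'a \<Rightarrow> ('a \<times> 'a) set" where
  "fraction R a s = fraction_rel R `` {(a, s)}"

definition to_quotients :: "('a, 'k) ring_scheme \<Rightarrow> 'a \<Rightarrow> ('a \<times> 'a) set" where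
  "to_quotients R r = fraction R r \<one>\<^bsub>R\<^esub>"

text \<open>The total ring of quotients carries its \<open>R\<close>-module structure as well, so that the library's
  notion of submodule applies. Each union below is over representatives of the classes involved,
  which all give the same class.\<close>

definition total_ring_of_quotients ::
  "('a, 'k) ring_scheme \<Rightarrow> ('a, ('a \<times> 'a) set) module" where
  "total_ring_of_quotients R =
     \<lparr>carrier = (carrier R \<times> regular_elements R) // fraction_rel R,
      monoid.mult = (\<lambda>x y. \<Union>(a, s) \<in> x. \<Union>(b, t) \<in> y. fraction R (a \<otimes>\<^bsub>R\<^esub> b) (s \<otimes>\<^bsub>R\<^esub> t)),
      one = fraction R \<one>\<^bsub>R\<^esub> \<one>\<^bsub>R\<^esub>,
      ring.zero = fraction R \<zero>\<^bsub>R\<^esub> \<one>\<^bsub>R\<^esub>,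
      add = (\<lambda>x y. \<Union>(a, s) \<in> x. \<Union>(b, t) \<in> y.
               fraction R (a \<otimes>\<^bsub>R\<^esub> t \<oplus>\<^bsub>R\<^esub> b \<otimes>\<^bsub>R\<^esub> s) (s \<otimes>\<^bsub>R\<^esub> t)),
      smult = (\<lambda>r x. \<Union>(a, s) \<in> x. fraction R (r \<otimes>\<^bsub>R\<^esub> a) s)\<rparr>"

definition fractional_ideal :: "('a, 'k) ring_scheme \<Rightarrow> ('a \<times> 'a) set set \<Rightarrow> bool" where
  "fractional_ideal R F \<longleftrightarrow>
     submodule F R (total_ring_of_quotients R) \<and>
     (\<exists>d \<in> regular_elements R. \<forall>x \<in> F.
        d \<odot>\<^bsub>total_ring_of_quotients R\<^esub> x \<in> to_quotients R ` carrier R)"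

text \<open>\<^const>\<open>ideal_prod\<close> forms the finite sums of products of elements of any two sets,
  so it also gives the product of fractional ideals.\<close>

definition invertible_fractional_ideal ::
  "('a, 'k) ring_scheme \<Rightarrow> ('a \<times> 'a) set set \<Rightarrow> bool" where
  "invertible_fractional_ideal R F \<longleftrightarrow>
     fractional_ideal R F \<and>
     (\<exists>G. fractional_ideal R G \<and>
        ideal_prod (total_ring_of_quotients R) F G = to_quotients R ` carrier R)"

definition finitely_generated_ideal :: "('a, 'k) ring_scheme \<Rightarrow> 'a set \<Rightarrow> bool" where
  "finitely_generated_ideal R I \<longleftrightarrow> (\<exists>S. finite S \<and> S \<subseteq> carrier R \<and> I = Idl\<^bsub>R\<^esub> S)"

definition prufer_ring :: "('a, 'k) ring_scheme \<Rightarrow> bool" where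
  "prufer_ring R \<longleftrightarrow>
     cring R \<and>
     (\<forall>I. ideal I R \<longrightarrow> finitely_generated_ideal R I \<longrightarrow> I \<inter> regular_elements R \<noteq> {} \<longrightarrow>
        invertible_fractional_ideal R (to_quotients R ` I))"

end

theory Submission
  imports Defs
begin

text \<open>Let \<open>R\<close> be the bi-amalgamation. An element \<open>(f a + j, g a + j')\<close> of \<open>R\<close> with \<open>a\<close> a unit is a unit,
  as \<open>j\<close> and \<open>j'\<close> square to zero. If \<open>a\<close> is not a unit, then \<open>a x = 0\<close> for some \<open>x \<noteq> 0\<close>, and
  \<open>(f a + j, g a + j')\<close> is annihilated by \<open>(f x j, g x j')\<close> if this is nonzero, and otherwise by
  \<open>(f x, g x)\<close>, which is nonzero as \<open>f\<close> is injective. Hence \<open>R\<close> is a total ring of quotients whose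
  nonunits are the elements with \<open>a \<in> m\<close>; these are closed under addition, so \<open>R\<close> is local. In a
  total ring of quotients the only regular ideal is the unit ideal, which is invertible.\<close>

section \<open>Local rings and nonunits\<close>

text \<open>Zorn's lemma for the ideals that contain \<open>I\<close> and miss
  \<open>\<one>\<close>. Properness is phrased as missing \<open>\<one>\<close> because that form
  visibly survives unions of chains.\<close>

lemma (in cring) exists_maximalideal:
  assumes "ideal I R" and "I \<noteq> carrier R"
  shows "\<exists>M. maximalideal M R \<and> I \<subseteq> M"
proof -
  define S where "S = {K. ideal K R \<and> I \<subseteq> K \<and> \<one> \<notin> K}"
  have proper: "K \<noteq> carrier R \<longleftrightarrow> \<one> \<notin> K" if "ideal K R" for K
    using ideal.one_imp_carrier[OF that] by auto
  have "\<exists>M\<in>S. \<forall>N\<in>S. M \<subseteq> N \<longrightarrow> N = M"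
  proof (rule subset_Zorn_nonempty)
    show "S \<noteq> {}" using assms proper by (auto simp: S_def)
  next
    fix K assume K: "K \<noteq> {}" "subset.chain S K"
    then have sub: "K \<subseteq> S" by (simp add: pred_on.chain_def)
    \<comment> \<open>The chain is viewed among all ideals, where its union is known to be an
      ideal.\<close>
    have "subset.chain {I. ideal I R} K"
      using K by (auto simp: pred_on.chain_def S_def)
    then have "ideal (\<Union>K) R"
      using chain_Union_is_ideal[of K] K(1) by simp
    then show "\<Union>K \<in> S" using sub K(1) by (fastforce simp: S_def)
  qed
  then obtain M where M: "M \<in> S" "\<And>N. N \<in> S \<Longrightarrow> M \<subseteq> N \<Longrightarrow> N = M" by blast
  have "maximalideal M R"
  proof (rule maximalidealI)
    show "ideal M R" "carrier R \<noteq> M" using M(1) by (auto simp: S_def)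
  next
    fix K assume K: "ideal K R" "M \<subseteq> K" "K \<subseteq> carrier R"
    show "K = M \<or> K = carrier R"
      using M K proper[OF K(1)] by (auto simp: S_def)
  qed
  then show ?thesis using M(1) by (auto simp: S_def)
qed

lemma (in cring) Units_in_proper_ideal:
  assumes "ideal I R" and "I \<noteq> carrier R" and "u \<in> I"
  shows "u \<notin> Units R"
proof
  assume "u \<in> Units R"
  then have "\<one> \<in> I" using assms ideal.I_l_closed[OF assms(1,3), of "inv u"] by simp
  then show False using ideal.one_imp_carrier[OF assms(1)] assms(2) by simp
qed

text \<open>A nonunit generates a proper principal ideal; some maximal ideal contains it, and that
  can only be \<open>M\<close>. A unit lies in no proper ideal.\<close>

lemma local_ring_maximalideal_eq:
  fixes R (structure)
  assumes "local_ring R" and "maximalideal M R"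
  shows "M = carrier R - Units R"
proof -
  interpret cring R using assms(1) by (simp add: local_ring_def)
  interpret M: maximalideal M R by fact
  have "x \<in> M" if x: "x \<in> carrier R" "x \<notin> Units R" for x
  proof -
    have "PIdl x \<noteq> carrier R" using ideal_eq_carrier_iff[OF x(1)] x(2) by auto
    then obtain N where "maximalideal N R" "PIdl x \<subseteq> N"
      using exists_maximalideal[OF cgenideal_ideal[OF x(1)]] by blast
    moreover then have "N = M" using assms by (auto simp: local_ring_def)
    ultimately show ?thesis using cgenideal_self[OF x(1)] by blast
  qed
  moreover have "x \<notin> Units R" if "x \<in> M" for x
    using Units_in_proper_ideal[OF M.is_ideal _ that] M.I_notcarr by auto
  ultimately show ?thesis using M.a_subset by blast
qed

text \<open>Nonunits always absorb multiplication, so closure under addition makes them an ideal.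
  Every proper ideal consists of nonunits, so this ideal is the largest proper one and hence the
  only maximal one.\<close>

lemma (in cring) local_ringI:
  assumes "\<one> \<noteq> \<zero>"
    and add: "\<And>x y. \<lbrakk>x \<in> carrier R - Units R; y \<in> carrier R - Units R\<rbrakk> \<Longrightarrow> x \<oplus> y \<notin> Units R"
  shows "local_ring R"
proof -
  let ?N = "carrier R - Units R"
  have mult: "x \<otimes> y \<in> ?N" if "x \<in> carrier R" "y \<in> ?N" for x y
    using that unit_factor[of y x] by (auto simp: m_comm)
  then have mult': "y \<otimes> x \<in> ?N" if "x \<in> carrier R" "y \<in> ?N" for x y
    using that by (metis DiffD1 m_comm)
  have ideal: "ideal ?N R"
  proof (rule idealI[OF ring_axioms])
    show "subgroup ?N (add_monoid R)"
    proof (rule add.subgroupI)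
      \<comment> \<open>In a nonzero ring, zero is a nonunit.\<close>
      show "?N \<noteq> {}" using assms(1) Units_r_inv_ex[of \<zero>] by force
      show "\<ominus> a \<in> ?N" if "a \<in> ?N" for a
        using mult[of "\<ominus> \<one>" a] that by (simp add: l_minus)
    qed (use add in auto)
  qed (use mult mult' in blast)+
  have proper: "I \<subseteq> ?N" if "ideal I R" "I \<noteq> carrier R" for I
    using Units_in_proper_ideal[OF that] ideal.Icarr[OF that(1)] by blast
  have "maximalideal ?N R"
    using proper by (intro maximalidealI ideal) auto
  moreover have "M = ?N" if "maximalideal M R" for M
  proof -
    interpret M: maximalideal M R by fact
    show ?thesis
      using proper[OF M.is_ideal] M.I_notcarr M.I_maximal[OF ideal] Units_one_closed by blast
  qed
  ultimately show ?thesis unfolding local_ring_def using cring_axioms by blast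
qed

section \<open>Total rings of quotients\<close>

text \<open>Units can be cancelled from \<open>u x = 0\<close>; the other inclusion is the defining
  dichotomy. All denominators of fractions over \<open>R\<close> are thereby units.\<close>

lemma regular_elements_eq_Units:
  fixes R (structure)
  assumes "is_total_ring_of_quotients R"
  shows "regular_elements R = Units R"
proof -
  interpret cring R using assms by (simp add: is_total_ring_of_quotients_def)
  have "\<not> zero_divisor R u" if u: "u \<in> Units R" for u
  proof
    assume "zero_divisor R u"
    then obtain x where x: "x \<in> carrier R" "x \<noteq> \<zero>" "u \<otimes> x = \<zero>"
      by (auto simp: zero_divisor_def)
    then have "u \<otimes> x = u \<otimes> \<zero>" using u by (simp add: Units_closed)
    then show False using x u Units_l_cancel by blast
  qed
  then show ?thesis
    using assms by (auto simp: regular_elements_def is_total_ring_of_quotients_def)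
qed

text \<open>A fraction \<open>b/t\<close> equals \<open>r/1\<close> exactly when
  \<open>b = r t\<close>. This explicit form turns the unions over representatives in
  \<open>total_ring_of_quotients\<close> into unions over units.\<close>

lemma to_quotients_eq:
  fixes R (structure)
  assumes "is_total_ring_of_quotients R" and "r \<in> carrier R"
  shows "to_quotients R r = (\<lambda>t. (r \<otimes>\<^bsub>R\<^esub> t, t)) ` Units R"
proof -
  interpret cring R using assms by (simp add: is_total_ring_of_quotients_def)
  show ?thesis using assms(2)
    by (auto simp: Units_closed to_quotients_def fraction_def fraction_rel_def
        regular_elements_eq_Units[OF assms(1)])
qed

text \<open>The unit \<open>s\<close> cancels from \<open>r s t = b s\<close>. The numerator is
  written \<open>r s\<close>, the shape that the operations produce on representatives.\<close>

lemma fraction_eq_to_quotients: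
  fixes R (structure)
  assumes "is_total_ring_of_quotients R" and "r \<in> carrier R" and "s \<in> Units R"
  shows "fraction R (r \<otimes>\<^bsub>R\<^esub> s) s = to_quotients R r"
proof -
  interpret cring R using assms by (simp add: is_total_ring_of_quotients_def)
  have "r \<otimes> s \<otimes> t = b \<otimes> s \<longleftrightarrow> r \<otimes> t = b"
    if "b \<in> carrier R" "t \<in> Units R" for b t
  proof -
    have "r \<otimes> s \<otimes> t = s \<otimes> (r \<otimes> t)" "b \<otimes> s = s \<otimes> b"
      using that assms by (simp_all add: Units_closed m_ac)
    then show ?thesis using that assms by (simp add: Units_closed Units_l_cancel)
  qed
  then show ?thesis using assms(2,3)
    by (auto simp: Units_closed m_ac to_quotients_eq[OF assms(1,2)] fraction_def fraction_rel_def
        regular_elements_eq_Units[OF assms(1)])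
qed

text \<open>Since every denominator \<open>s\<close> is a unit, \<open>a/s\<close> is the image of
  \<open>a \<otimes> inv s\<close>. So \<open>q\<close> identifies \<open>R\<close> with its total
  ring of quotients, and computations there can be pulled back to \<open>R\<close>.\<close>

lemma total_ring_of_quotients_simps:
  fixes R (structure)
  assumes R: "is_total_ring_of_quotients R"
  defines "q \<equiv> to_quotients R" and "T \<equiv> total_ring_of_quotients R"
  shows "carrier T = q ` carrier R"
    and "\<zero>\<^bsub>T\<^esub> = q \<zero>\<^bsub>R\<^esub>"
    and "\<And>x y. \<lbrakk>x \<in> carrier R; y \<in> carrier R\<rbrakk> \<Longrightarrow> q x \<otimes>\<^bsub>T\<^esub> q y = q (x \<otimes>\<^bsub>R\<^esub> y)"
    and "\<And>x y. \<lbrakk>x \<in> carrier R; y \<in> carrier R\<rbrakk> \<Longrightarrow> q x \<oplus>\<^bsub>T\<^esub> q y = q (x \<oplus>\<^bsub>R\<^esub> y)"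
    and "\<And>x y. \<lbrakk>x \<in> carrier R; y \<in> carrier R\<rbrakk> \<Longrightarrow> x \<odot>\<^bsub>T\<^esub> q y = q (x \<otimes>\<^bsub>R\<^esub> y)"
    and "inj_on q (carrier R)"
proof -
  interpret cring R using R by (simp add: is_total_ring_of_quotients_def)
  note frac = fraction_eq_to_quotients[OF R, folded q_def]
  note q_eq = to_quotients_eq[OF R, folded q_def]
  \<comment> \<open>In each operation below, all choices of representatives give the same class
    \<open>K\<close>. The union of these equal terms is \<open>K\<close> because
    \<open>\<one>\<close> is a unit, so the index set is nonempty.\<close>
  have UN_Units: "(\<Union>t\<in>Units R. K) = K" for K :: "('a \<times> 'a) set" by auto
  have frac_q: "fraction R a s = q (a \<otimes> inv s)" if "a \<in> carrier R" "s \<in> Units R" for a s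
    using frac[of "a \<otimes> inv s" s] that by (simp add: Units_closed m_assoc)
  have "carrier T = (\<lambda>(a, s). fraction R a s) ` (carrier R \<times> Units R)"
    by (auto simp: T_def total_ring_of_quotients_def quotient_def fraction_def
        regular_elements_eq_Units[OF R] image_iff)
  also have "\<dots> = q ` carrier R"
  proof
    show "(\<lambda>(a, s). fraction R a s) ` (carrier R \<times> Units R) \<subseteq> q ` carrier R"
      by (auto simp: frac_q Units_inv_closed)
    show "q ` carrier R \<subseteq> (\<lambda>(a, s). fraction R a s) ` (carrier R \<times> Units R)"
      by (force simp: q_def to_quotients_def)
  qed
  finally show "carrier T = q ` carrier R" .
  show "\<zero>\<^bsub>T\<^esub> = q \<zero>"
    by (simp add: T_def total_ring_of_quotients_def q_def to_quotients_def)
  show "q x \<otimes>\<^bsub>T\<^esub> q y = q (x \<otimes> y)" if xy: "x \<in> carrier R" "y \<in> carrier R" for x y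
  proof -
    \<comment> \<open>The representatives \<open>(x s, s)\<close> and \<open>(y t, t)\<close>
      multiply to \<open>(x y s t, s t)\<close>, from which the unit \<open>s t\<close>
      cancels.\<close>
    have "fraction R (x \<otimes> s \<otimes> (y \<otimes> t)) (s \<otimes> t) = q (x \<otimes> y)" if "s \<in> Units R" "t \<in> Units R" for s t
      using frac[of "x \<otimes> y" "s \<otimes> t"] xy that by (simp add: Units_closed m_ac)
    then have "q x \<otimes>\<^bsub>T\<^esub> q y = (\<Union>s\<in>Units R. \<Union>t\<in>Units R. q (x \<otimes> y))"
      by (simp add: T_def total_ring_of_quotients_def q_eq xy cong: SUP_cong_simp)
    then show ?thesis by (simp only: UN_Units)
  qed
  show "q x \<oplus>\<^bsub>T\<^esub> q y = q (x \<oplus> y)" if xy: "x \<in> carrier R" "y \<in> carrier R" for x y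
  proof -
    have "fraction R (x \<otimes> s \<otimes> t \<oplus> y \<otimes> t \<otimes> s) (s \<otimes> t) = q (x \<oplus> y)"
      if "s \<in> Units R" "t \<in> Units R" for s t
      using frac[of "x \<oplus> y" "s \<otimes> t"] xy that by (simp add: Units_closed m_ac l_distr r_distr)
    then have "q x \<oplus>\<^bsub>T\<^esub> q y = (\<Union>s\<in>Units R. \<Union>t\<in>Units R. q (x \<oplus> y))"
      by (simp add: T_def total_ring_of_quotients_def q_eq xy cong: SUP_cong_simp)
    then show ?thesis by (simp only: UN_Units)
  qed
  show "x \<odot>\<^bsub>T\<^esub> q y = q (x \<otimes> y)" if xy: "x \<in> carrier R" "y \<in> carrier R" for x y
  proof -
    have "fraction R (x \<otimes> (y \<otimes> t)) t = q (x \<otimes> y)" if "t \<in> Units R" for t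
      using frac[of "x \<otimes> y" t] xy that by (simp add: Units_closed m_ac)
    then have "x \<odot>\<^bsub>T\<^esub> q y = (\<Union>t\<in>Units R. q (x \<otimes> y))"
      by (simp add: T_def total_ring_of_quotients_def q_eq xy cong: SUP_cong_simp)
    then show ?thesis by (simp only: UN_Units)
  qed
  show "inj_on q (carrier R)"
  proof (rule inj_onI)
    fix x y assume xy: "x \<in> carrier R" "y \<in> carrier R" "q x = q y"
    \<comment> \<open>The representative with denominator \<open>\<one>\<close> determines the
      element.\<close>
    have "(x \<otimes> \<one>, \<one>) \<in> q x" using xy(1) by (simp add: q_eq image_iff)
    then have "(x \<otimes> \<one>, \<one>) \<in> q y" using xy(3) by simp
    then show "x = y" using xy(1,2) by (auto simp: q_eq)
  qed
qed

text \<open>The image of \<open>R\<close> is its own inverse: it is closed under products and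
  contains \<open>\<one>\<close>. The common denominator required of a fractional ideal is
  \<open>\<one>\<close>.\<close>

lemma invertible_unit_ideal:
  fixes R (structure)
  assumes R: "is_total_ring_of_quotients R"
  shows "invertible_fractional_ideal R (to_quotients R ` carrier R)"
proof -
  interpret cring R using R by (simp add: is_total_ring_of_quotients_def)
  let ?q = "to_quotients R" and ?T = "total_ring_of_quotients R"
  note [simp] = total_ring_of_quotients_simps[OF R]
  have inj: "?q x = ?q y \<longleftrightarrow> x = y" if "x \<in> carrier R" "y \<in> carrier R" for x y
    using inj_on_eq_iff[OF total_ring_of_quotients_simps(6)[OF R]] that by blast
  \<comment> \<open>A submodule must be closed under additive inverses, and \<open>m_inv\<close> is
    a definite description. Uniqueness is pulled back to \<open>R\<close> along the injective
    \<open>?q\<close>, where \<open>y \<oplus> x = \<zero>\<close> forces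
    \<open>y = \<ominus> x\<close>.\<close>
  have inv: "m_inv (add_monoid ?T) (?q x) = ?q (\<ominus> x)" if x: "x \<in> carrier R" for x
    unfolding m_inv_def
  proof (rule the_equality)
    show "?q (\<ominus> x) \<in> carrier (add_monoid ?T) \<and>
        ?q x \<otimes>\<^bsub>add_monoid ?T\<^esub> ?q (\<ominus> x) = \<one>\<^bsub>add_monoid ?T\<^esub> \<and>
        ?q (\<ominus> x) \<otimes>\<^bsub>add_monoid ?T\<^esub> ?q x = \<one>\<^bsub>add_monoid ?T\<^esub>"
      using x by (simp add: r_neg l_neg)
  next
    fix z assume z: "z \<in> carrier (add_monoid ?T) \<and>
        ?q x \<otimes>\<^bsub>add_monoid ?T\<^esub> z = \<one>\<^bsub>add_monoid ?T\<^esub> \<and> z \<otimes>\<^bsub>add_monoid ?T\<^esub> ?q x = \<one>\<^bsub>add_monoid ?T\<^esub>"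
    then obtain y where y: "y \<in> carrier R" "z = ?q y" by auto
    then have "y \<oplus> x = \<zero>" using z x by (simp add: inj)
    then have "y = \<ominus> x" using minus_equality x y(1) by simp
    then show "z = ?q (\<ominus> x)" using y(2) by simp
  qed
  have "submodule (?q ` carrier R) R ?T"
    by (intro submodule.intro subgroup.intro submodule_axioms.intro) (auto simp: inv[simplified])
  moreover have "\<one> \<in> regular_elements R"
    by (simp add: regular_elements_eq_Units[OF R])
  ultimately have frac: "fractional_ideal R (?q ` carrier R)"
    unfolding fractional_ideal_def by (intro conjI bexI[of _ \<one>]) auto
  have "z \<in> ?q ` carrier R" if "z \<in> ideal_prod ?T (?q ` carrier R) (?q ` carrier R)" for z
    using that by (induction rule: ideal_prod.induct) auto
  moreover have "?q x \<in> ideal_prod ?T (?q ` carrier R) (?q ` carrier R)" if "x \<in> carrier R" for x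
    using ideal_prod.prod[of "?q x" "?q ` carrier R" "?q \<one>" "?q ` carrier R" ?T] that by simp
  ultimately have "ideal_prod ?T (?q ` carrier R) (?q ` carrier R) = ?q ` carrier R" by blast
  with frac show ?thesis unfolding invertible_fractional_ideal_def by blast
qed

lemma total_ring_of_quotients_imp_prufer_ring:
  fixes R (structure)
  assumes R: "is_total_ring_of_quotients R"
  shows "prufer_ring R"
  unfolding prufer_ring_def
proof (intro conjI allI impI)
  show "cring R" using R by (simp add: is_total_ring_of_quotients_def)
  then interpret cring R .
  fix I assume I: "ideal I R" "I \<inter> regular_elements R \<noteq> {}"
  then have "I = carrier R"
    using Units_in_proper_ideal by (fastforce simp: regular_elements_eq_Units[OF R])
  then show "invertible_fractional_ideal R (to_quotients R ` I)"
    using invertible_unit_ideal[OF R] by simp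
qed

section \<open>The bi-amalgamation along ideals of square zero\<close>

lemma bi_amalgamation_simps:
  "carrier (bi_amalgamation A B C f g J J') =
    {(f a \<oplus>\<^bsub>B\<^esub> j, g a \<oplus>\<^bsub>C\<^esub> j') | a j j'. a \<in> carrier A \<and> j \<in> J \<and> j' \<in> J'}"
  "\<zero>\<^bsub>bi_amalgamation A B C f g J J'\<^esub> = (\<zero>\<^bsub>B\<^esub>, \<zero>\<^bsub>C\<^esub>)"
  "\<one>\<^bsub>bi_amalgamation A B C f g J J'\<^esub> = (\<one>\<^bsub>B\<^esub>, \<one>\<^bsub>C\<^esub>)"
  "(b, c) \<oplus>\<^bsub>bi_amalgamation A B C f g J J'\<^esub> (b', c') = (b \<oplus>\<^bsub>B\<^esub> b', c \<oplus>\<^bsub>C\<^esub> c')"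
  "(b, c) \<otimes>\<^bsub>bi_amalgamation A B C f g J J'\<^esub> (b', c') = (b \<otimes>\<^bsub>B\<^esub> b', c \<otimes>\<^bsub>C\<^esub> c')"
  by (simp_all add: bi_amalgamation_def RDirProd_def DirProd_def monoid.defs)

text \<open>With \<open>v\<close> the inverse of \<open>u\<close>, the second factor is the
  geometric series for the inverse of \<open>u \<oplus> j\<close>. It stops after the linear term
  because \<open>j\<close> squares to zero.\<close>

lemma (in cring) square_zero_unit:
  assumes "u \<in> carrier R" "v \<in> carrier R" "j \<in> carrier R" "u \<otimes> v = \<one>" "j \<otimes> j = \<zero>"
  shows "(u \<oplus> j) \<otimes> (v \<oplus> \<ominus> (v \<otimes> v \<otimes> j)) = \<one>"
proof -
  have "u \<otimes> (v \<otimes> v \<otimes> j) = (u \<otimes> v) \<otimes> v \<otimes> j" "j \<otimes> (v \<otimes> v \<otimes> j) = v \<otimes> v \<otimes> (j \<otimes> j)"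
    using assms(1-3) by (simp_all add: m_ac)
  then have "u \<otimes> (v \<otimes> v \<otimes> j) = v \<otimes> j" "j \<otimes> (v \<otimes> v \<otimes> j) = \<zero>"
    using assms by simp_all
  then have "(u \<oplus> j) \<otimes> (v \<oplus> \<ominus> (v \<otimes> v \<otimes> j)) = \<one> \<oplus> \<ominus> (v \<otimes> j) \<oplus> v \<otimes> j"
    using assms by (simp add: l_distr r_distr r_minus m_comm a_ac)
  then show ?thesis using assms by (simp add: a_assoc l_neg)
qed

locale square_zero_bi_amalgamation =
  A: cring A + B: cring B + C: cring C + f: ring_hom_cring A B f + g: ring_hom_cring A C g +
  J: ideal J B + J': ideal J' C
  for A :: "('a, 'k) ring_scheme" and B :: "('b, 'l) ring_scheme" and C :: "('c, 'n) ring_scheme"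
    and f g J J' +
  assumes J_square: "\<And>x y. \<lbrakk>x \<in> J; y \<in> J\<rbrakk> \<Longrightarrow> x \<otimes>\<^bsub>B\<^esub> y = \<zero>\<^bsub>B\<^esub>"
    and J'_square: "\<And>x y. \<lbrakk>x \<in> J'; y \<in> J'\<rbrakk> \<Longrightarrow> x \<otimes>\<^bsub>C\<^esub> y = \<zero>\<^bsub>C\<^esub>"
begin

abbreviation R where "R \<equiv> bi_amalgamation A B C f g J J'"

lemma mem_carrierI:
  assumes "a \<in> carrier A" "j \<in> J" "j' \<in> J'"
  shows "(f a \<oplus>\<^bsub>B\<^esub> j, g a \<oplus>\<^bsub>C\<^esub> j') \<in> carrier R"
  using assms by (auto simp: bi_amalgamation_simps)

lemma J_prod_closed: "\<lbrakk>j \<in> J; j' \<in> J'\<rbrakk> \<Longrightarrow> (j, j') \<in> carrier R"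
  using mem_carrierI[of "\<zero>\<^bsub>A\<^esub>" j j'] by simp

lemma hom_pair_closed: "a \<in> carrier A \<Longrightarrow> (f a, g a) \<in> carrier R"
  using mem_carrierI[of a "\<zero>\<^bsub>B\<^esub>" "\<zero>\<^bsub>C\<^esub>"] by simp

lemma carrierE:
  assumes "x \<in> carrier R"
  obtains a j j' where "a \<in> carrier A" "j \<in> J" "j' \<in> J'" "x = (f a \<oplus>\<^bsub>B\<^esub> j, g a \<oplus>\<^bsub>C\<^esub> j')"
  using assms by (auto simp: bi_amalgamation_simps)

lemma add_eq:
  assumes "a \<in> carrier A" "j \<in> J" "j' \<in> J'" "b \<in> carrier A" "k \<in> J" "k' \<in> J'"
  shows "(f a \<oplus>\<^bsub>B\<^esub> j, g a \<oplus>\<^bsub>C\<^esub> j') \<oplus>\<^bsub>R\<^esub> (f b \<oplus>\<^bsub>B\<^esub> k, g b \<oplus>\<^bsub>C\<^esub> k') =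
    (f (a \<oplus>\<^bsub>A\<^esub> b) \<oplus>\<^bsub>B\<^esub> (j \<oplus>\<^bsub>B\<^esub> k), g (a \<oplus>\<^bsub>A\<^esub> b) \<oplus>\<^bsub>C\<^esub> (j' \<oplus>\<^bsub>C\<^esub> k'))"
  using assms by (simp add: bi_amalgamation_simps B.a_ac C.a_ac)

text \<open>The terms \<open>j k\<close> and \<open>j' k'\<close> vanish. The remaining cross terms
  lie in \<open>J\<close> and \<open>J'\<close>, so the product again has the shape required by
  \<open>mem_carrierI\<close>, from which closure follows.\<close>

lemma mult_eq:
  assumes "a \<in> carrier A" "j \<in> J" "j' \<in> J'" "b \<in> carrier A" "k \<in> J" "k' \<in> J'"
  shows "(f a \<oplus>\<^bsub>B\<^esub> j, g a \<oplus>\<^bsub>C\<^esub> j') \<otimes>\<^bsub>R\<^esub> (f b \<oplus>\<^bsub>B\<^esub> k, g b \<oplus>\<^bsub>C\<^esub> k') =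
    (f (a \<otimes>\<^bsub>A\<^esub> b) \<oplus>\<^bsub>B\<^esub> (f a \<otimes>\<^bsub>B\<^esub> k \<oplus>\<^bsub>B\<^esub> f b \<otimes>\<^bsub>B\<^esub> j),
     g (a \<otimes>\<^bsub>A\<^esub> b) \<oplus>\<^bsub>C\<^esub> (g a \<otimes>\<^bsub>C\<^esub> k' \<oplus>\<^bsub>C\<^esub> g b \<otimes>\<^bsub>C\<^esub> j'))"
  using assms
  by (simp add: bi_amalgamation_simps B.l_distr B.r_distr C.l_distr C.r_distr
      B.a_ac C.a_ac B.m_comm C.m_comm J_square J'_square)

lemma cring_R: "cring R"
proof (rule cringI)
  have closed: "x \<oplus>\<^bsub>R\<^esub> y \<in> carrier R" "x \<otimes>\<^bsub>R\<^esub> y \<in> carrier R"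
    if "x \<in> carrier R" "y \<in> carrier R" for x y
    using that
    \<comment> \<open>The homomorphism rules are disabled so that \<open>f\<close> and
      \<open>g\<close> of a sum or product are not expanded; otherwise the shape needed by
      \<open>mem_carrierI\<close> would be lost.\<close>
    by (auto elim!: carrierE simp: add_eq mult_eq intro!: mem_carrierI J.a_closed J'.a_closed J.I_l_closed J'.I_l_closed
        simp del: f.hom_add g.hom_add f.hom_mult g.hom_mult)
  have mem: "fst x \<in> carrier B" "snd x \<in> carrier C" if "x \<in> carrier R" for x
    using that by (auto elim!: carrierE)
  \<comment> \<open>The ring identities are checked in each component, where they hold in
    \<open>B\<close> and \<open>C\<close>.\<close>
  have simps: "x \<oplus>\<^bsub>R\<^esub> y = (fst x \<oplus>\<^bsub>B\<^esub> fst y, snd x \<oplus>\<^bsub>C\<^esub> snd y)"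
    "x \<otimes>\<^bsub>R\<^esub> y = (fst x \<otimes>\<^bsub>B\<^esub> fst y, snd x \<otimes>\<^bsub>C\<^esub> snd y)" for x y
    by (cases x; cases y; simp add: bi_amalgamation_simps)+
  show "abelian_group R"
  proof (rule abelian_groupI)
    show "\<zero>\<^bsub>R\<^esub> \<in> carrier R" using J_prod_closed by (simp add: bi_amalgamation_simps(2))
    show "\<exists>y\<in>carrier R. y \<oplus>\<^bsub>R\<^esub> x = \<zero>\<^bsub>R\<^esub>" if mem_x: "x \<in> carrier R" for x
    proof -
      obtain a j j' where x: "a \<in> carrier A" "j \<in> J" "j' \<in> J'"
        "x = (f a \<oplus>\<^bsub>B\<^esub> j, g a \<oplus>\<^bsub>C\<^esub> j')" using carrierE[OF mem_x] by blast
      show ?thesis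
      proof
        \<comment> \<open>The negative is written with the signs moved onto \<open>a\<close>,
          \<open>j\<close> and \<open>j'\<close>, so that it visibly lies in
          \<open>R\<close>.\<close>
        show "(f (\<ominus>\<^bsub>A\<^esub> a) \<oplus>\<^bsub>B\<^esub> \<ominus>\<^bsub>B\<^esub> j, g (\<ominus>\<^bsub>A\<^esub> a) \<oplus>\<^bsub>C\<^esub> \<ominus>\<^bsub>C\<^esub> j') \<in> carrier R"
          using x by (intro mem_carrierI) auto
        show "(f (\<ominus>\<^bsub>A\<^esub> a) \<oplus>\<^bsub>B\<^esub> \<ominus>\<^bsub>B\<^esub> j, g (\<ominus>\<^bsub>A\<^esub> a) \<oplus>\<^bsub>C\<^esub> \<ominus>\<^bsub>C\<^esub> j') \<oplus>\<^bsub>R\<^esub> x = \<zero>\<^bsub>R\<^esub>"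
          using x by (simp add: add_eq A.l_neg B.l_neg C.l_neg bi_amalgamation_simps(2)
              del: f.hom_add g.hom_add f.hom_a_inv g.hom_a_inv)
      qed
    qed
  qed (simp_all add: closed, simp_all add: simps mem B.a_ac C.a_ac bi_amalgamation_simps(2))
  show "comm_monoid R"
    using hom_pair_closed[OF A.one_closed]
    by (intro comm_monoidI)
      (simp_all add: closed bi_amalgamation_simps(3), simp_all add: simps mem B.m_ac C.m_ac)
  show "(x \<oplus>\<^bsub>R\<^esub> y) \<otimes>\<^bsub>R\<^esub> z = x \<otimes>\<^bsub>R\<^esub> z \<oplus>\<^bsub>R\<^esub> y \<otimes>\<^bsub>R\<^esub> z"
    if "x \<in> carrier R" "y \<in> carrier R" "z \<in> carrier R" for x y z
    using that by (simp add: simps mem B.l_distr C.l_distr)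
qed

text \<open>Both components are inverted by \<open>square_zero_unit\<close>. The same inverse
  \<open>b\<close> of \<open>a\<close> serves in \<open>B\<close> and in \<open>C\<close>, and the
  correction terms lie in \<open>J\<close> and \<open>J'\<close>; hence the pair of inverses belongs
  to \<open>R\<close>.\<close>

lemma Units_R:
  assumes "a \<in> Units A" "j \<in> J" "j' \<in> J'"
  shows "(f a \<oplus>\<^bsub>B\<^esub> j, g a \<oplus>\<^bsub>C\<^esub> j') \<in> Units R" (is "?x \<in> _")
proof -
  interpret R: cring R by (rule cring_R)
  obtain b where b: "b \<in> carrier A" "a \<otimes>\<^bsub>A\<^esub> b = \<one>\<^bsub>A\<^esub>"
    using A.Units_r_inv_ex[OF assms(1)] by blast
  have a: "a \<in> carrier A" using assms(1) by blast
  let ?y = "(f b \<oplus>\<^bsub>B\<^esub> \<ominus>\<^bsub>B\<^esub> (f b \<otimes>\<^bsub>B\<^esub> f b \<otimes>\<^bsub>B\<^esub> j), g b \<oplus>\<^bsub>C\<^esub> \<ominus>\<^bsub>C\<^esub> (g b \<otimes>\<^bsub>C\<^esub> g b \<otimes>\<^bsub>C\<^esub> j'))"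
  have "f a \<otimes>\<^bsub>B\<^esub> f b = \<one>\<^bsub>B\<^esub>" "g a \<otimes>\<^bsub>C\<^esub> g b = \<one>\<^bsub>C\<^esub>"
    using a b by (simp_all flip: f.hom_mult g.hom_mult)
  then have "?x \<otimes>\<^bsub>R\<^esub> ?y = \<one>\<^bsub>R\<^esub>"
    using a b assms
    by (simp add: bi_amalgamation_simps(3,5) B.square_zero_unit C.square_zero_unit
        J_square J'_square)
  moreover have "?x \<in> carrier R" "?y \<in> carrier R"
    using a b assms by (auto intro!: mem_carrierI J.I_l_closed J'.I_l_closed)
  ultimately show ?thesis using R.m_comm[of ?x ?y] by (auto simp: Units_def)
qed

lemma zero_divisor_R:
  assumes "inj_on f (carrier A)" and "zero_divisor A a" and "j \<in> J" "j' \<in> J'"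
  shows "zero_divisor R (f a \<oplus>\<^bsub>B\<^esub> j, g a \<oplus>\<^bsub>C\<^esub> j')" (is "zero_divisor R ?z")
proof -
  obtain x where a: "a \<in> carrier A" and x: "x \<in> carrier A" "x \<noteq> \<zero>\<^bsub>A\<^esub>" "a \<otimes>\<^bsub>A\<^esub> x = \<zero>\<^bsub>A\<^esub>"
    using assms(2) by (auto simp: zero_divisor_def)
  have fx: "f a \<otimes>\<^bsub>B\<^esub> f x = \<zero>\<^bsub>B\<^esub>" and gx: "g a \<otimes>\<^bsub>C\<^esub> g x = \<zero>\<^bsub>C\<^esub>"
    using a x by (simp_all flip: f.hom_mult g.hom_mult)
  have "f x \<noteq> \<zero>\<^bsub>B\<^esub>"
    using inj_onD[OF assms(1), of x "\<zero>\<^bsub>A\<^esub>"] x by auto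
  \<comment> \<open>The part \<open>f a\<close> kills \<open>f x\<close>, and \<open>j\<close> kills
    \<open>f x \<otimes> k\<close> because both lie in \<open>J\<close>. Below, \<open>k\<close> is
    \<open>j\<close> itself.\<close>
  have annB: "(f a \<oplus>\<^bsub>B\<^esub> j) \<otimes>\<^bsub>B\<^esub> (f x \<otimes>\<^bsub>B\<^esub> k) = \<zero>\<^bsub>B\<^esub>" if "k \<in> J" for k
  proof -
    have "f a \<otimes>\<^bsub>B\<^esub> (f x \<otimes>\<^bsub>B\<^esub> k) = (f a \<otimes>\<^bsub>B\<^esub> f x) \<otimes>\<^bsub>B\<^esub> k"
      using a x that by (simp add: B.m_assoc)
    then show ?thesis
      using a x that assms fx by (simp add: B.l_distr J_square J.I_l_closed)
  qed
  have annC: "(g a \<oplus>\<^bsub>C\<^esub> j') \<otimes>\<^bsub>C\<^esub> (g x \<otimes>\<^bsub>C\<^esub> k) = \<zero>\<^bsub>C\<^esub>" if "k \<in> J'" for k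
  proof -
    have "g a \<otimes>\<^bsub>C\<^esub> (g x \<otimes>\<^bsub>C\<^esub> k) = (g a \<otimes>\<^bsub>C\<^esub> g x) \<otimes>\<^bsub>C\<^esub> k"
      using a x that by (simp add: C.m_assoc)
    then show ?thesis
      using a x that assms gx by (simp add: C.l_distr J'_square J'.I_l_closed)
  qed
  have "\<exists>w \<in> carrier R. w \<noteq> \<zero>\<^bsub>R\<^esub> \<and> ?z \<otimes>\<^bsub>R\<^esub> w = \<zero>\<^bsub>R\<^esub>"
  \<comment> \<open>The pair \<open>(f x, g x)\<close> is always killed by
    \<open>(f a, g a)\<close>, so only the products with \<open>j\<close> and \<open>j'\<close> can
    obstruct. If they do not both vanish, they form the nonzero annihilator themselves.\<close>
  proof (cases "f x \<otimes>\<^bsub>B\<^esub> j = \<zero>\<^bsub>B\<^esub> \<and> g x \<otimes>\<^bsub>C\<^esub> j' = \<zero>\<^bsub>C\<^esub>")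
    case True
    then have "?z \<otimes>\<^bsub>R\<^esub> (f x, g x) = \<zero>\<^bsub>R\<^esub>"
      using a x assms fx gx
      by (simp add: bi_amalgamation_simps(2,5) B.l_distr C.l_distr B.m_comm[of j] C.m_comm[of j'])
    then show ?thesis
      using hom_pair_closed[OF x(1)] \<open>f x \<noteq> \<zero>\<^bsub>B\<^esub>\<close> by (auto simp: bi_amalgamation_simps(2))
  next
    case False
    moreover have "?z \<otimes>\<^bsub>R\<^esub> (f x \<otimes>\<^bsub>B\<^esub> j, g x \<otimes>\<^bsub>C\<^esub> j') = \<zero>\<^bsub>R\<^esub>"
      using annB annC assms by (simp add: bi_amalgamation_simps(2,5))
    moreover have "(f x \<otimes>\<^bsub>B\<^esub> j, g x \<otimes>\<^bsub>C\<^esub> j') \<in> carrier R"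
      using x assms by (intro J_prod_closed J.I_l_closed J'.I_l_closed) auto
    ultimately show ?thesis by (auto simp: bi_amalgamation_simps(2))
  qed
  then show ?thesis
    using mem_carrierI[OF a assms(3,4)] by (simp add: zero_divisor_def)
qed

lemma total_ring_of_quotients_R:
  assumes "inj_on f (carrier A)" and "is_total_ring_of_quotients A"
  shows "is_total_ring_of_quotients R"
  using assms Units_R zero_divisor_R cring_R
  by (fastforce simp: is_total_ring_of_quotients_def elim!: carrierE)

text \<open>A nonunit \<open>a\<close> is a zero-divisor of \<open>A\<close>, which makes the pair a
  zero-divisor of \<open>R\<close>, and no unit of \<open>R\<close> is one. In particular the
  criterion does not depend on the representation chosen for the pair.\<close>

lemma Units_R_iff:
  assumes "inj_on f (carrier A)" and "is_total_ring_of_quotients A"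
    and "a \<in> carrier A" "j \<in> J" "j' \<in> J'"
  shows "(f a \<oplus>\<^bsub>B\<^esub> j, g a \<oplus>\<^bsub>C\<^esub> j') \<in> Units R \<longleftrightarrow> a \<in> Units A"
proof -
  have "a \<in> Units A" if "(f a \<oplus>\<^bsub>B\<^esub> j, g a \<oplus>\<^bsub>C\<^esub> j') \<in> Units R"
    using that zero_divisor_R[OF assms(1) _ assms(4,5), of a] assms(2,3)
      regular_elements_eq_Units[OF total_ring_of_quotients_R[OF assms(1,2)]]
    by (auto simp: regular_elements_def is_total_ring_of_quotients_def)
  then show ?thesis using Units_R assms(4,5) by blast
qed

lemma local_ring_R:
  assumes inj: "inj_on f (carrier A)" and tq: "is_total_ring_of_quotients A" and "local_ring A"
  shows "local_ring R"
proof -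
  interpret R: cring R by (rule cring_R)
  obtain m where "maximalideal m A" using assms(3) by (auto simp: local_ring_def)
  then interpret m: maximalideal m A .
  have m: "m = carrier A - Units A"
    using local_ring_maximalideal_eq assms(3) m.is_maximalideal by blast
  show ?thesis
  proof (rule R.local_ringI)
    \<comment> \<open>Zero lies in \<open>m\<close> and is therefore a nonunit of \<open>A\<close>.
      Injectivity of \<open>f\<close> then carries nontriviality over to \<open>B\<close>, and so to
      the first component of \<open>R\<close>.\<close>
    have "\<one>\<^bsub>A\<^esub> \<noteq> \<zero>\<^bsub>A\<^esub>"
      using m m.zero_closed by auto
    then have "\<one>\<^bsub>B\<^esub> \<noteq> \<zero>\<^bsub>B\<^esub>"
      using inj_onD[OF inj, of "\<one>\<^bsub>A\<^esub>" "\<zero>\<^bsub>A\<^esub>"] by auto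
    then show "\<one>\<^bsub>R\<^esub> \<noteq> \<zero>\<^bsub>R\<^esub>" by (simp add: bi_amalgamation_simps(2,3))
  next
    fix x y assume xy: "x \<in> carrier R - Units R" "y \<in> carrier R - Units R"
    obtain a j j' where x: "a \<in> carrier A" "j \<in> J" "j' \<in> J'"
      "x = (f a \<oplus>\<^bsub>B\<^esub> j, g a \<oplus>\<^bsub>C\<^esub> j')" using xy(1) carrierE by blast
    obtain b k k' where y: "b \<in> carrier A" "k \<in> J" "k' \<in> J'"
      "y = (f b \<oplus>\<^bsub>B\<^esub> k, g b \<oplus>\<^bsub>C\<^esub> k')" using xy(2) carrierE by blast
    \<comment> \<open>Nonunits of \<open>R\<close> are exactly the elements lying over
      \<open>m\<close>, so closure under addition is inherited from \<open>m\<close>.\<close>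
    have "a \<in> m" "b \<in> m"
      using xy x y Units_R_iff[OF inj tq] by (auto simp: m)
    then have "a \<oplus>\<^bsub>A\<^esub> b \<notin> Units A" using m.a_closed m by blast
    moreover have "x \<oplus>\<^bsub>R\<^esub> y = (f (a \<oplus>\<^bsub>A\<^esub> b) \<oplus>\<^bsub>B\<^esub> (j \<oplus>\<^bsub>B\<^esub> k), g (a \<oplus>\<^bsub>A\<^esub> b) \<oplus>\<^bsub>C\<^esub> (j' \<oplus>\<^bsub>C\<^esub> k'))"
      using x y add_eq by simp
    ultimately show "x \<oplus>\<^bsub>R\<^esub> y \<notin> Units R"
      using Units_R_iff[OF inj tq, of "a \<oplus>\<^bsub>A\<^esub> b" "j \<oplus>\<^bsub>B\<^esub> k" "j' \<oplus>\<^bsub>C\<^esub> k'"] x y by auto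
  qed
qed

end

theorem proposition2p6:
  fixes A :: "('a, 'k) ring_scheme" and B :: "('b, 'l) ring_scheme" and C :: "('c, 'n) ring_scheme"
    and f :: "'a \<Rightarrow> 'b" and g :: "'a \<Rightarrow> 'c"
    and m :: "'a set" and J :: "'b set" and J' :: "'c set"
  assumes "cring A"
    and "cring B" and "cring C"
    and "local_ring A" and "maximalideal m A"
    and "is_total_ring_of_quotients A"
    and "f \<in> ring_hom A B" and "g \<in> ring_hom A C"
    and "ideal J B" and "J \<noteq> {\<zero>\<^bsub>B\<^esub>}" and "J \<noteq> carrier B"
    and "ideal J' C" and "J' \<noteq> {\<zero>\<^bsub>C\<^esub>}" and "J' \<noteq> carrier C"
    and "{a \<in> carrier A. f a \<in> J} = {a \<in> carrier A. g a \<in> J'}"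
    and "J \<times> J' \<subseteq> Jac (RDirProd B C)"
    and "inj_on f (carrier A)"
    and "ideal_prod B J J = {\<zero>\<^bsub>B\<^esub>}" and "ideal_prod C J' J' = {\<zero>\<^bsub>C\<^esub>}"
  shows "local_ring (bi_amalgamation A B C f g J J')
    \<and> is_total_ring_of_quotients (bi_amalgamation A B C f g J J')
    \<and> prufer_ring (bi_amalgamation A B C f g J J')"
proof -
  have "square_zero_bi_amalgamation A B C f g J J'"
  proof (intro square_zero_bi_amalgamation.intro square_zero_bi_amalgamation_axioms.intro)
    show "ring_hom_cring A B f" "ring_hom_cring A C g"
      using assms by (auto intro!: ring_hom_cring.intro ring_hom_cring_axioms.intro)
    \<comment> \<open>Each single product is a member of \<open>ideal_prod B J J\<close>, which is
      zero.\<close>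
    show "x \<otimes>\<^bsub>B\<^esub> y = \<zero>\<^bsub>B\<^esub>" if "x \<in> J" "y \<in> J" for x y
      using ideal_prod.prod[of x J y J B] that assms by simp
    show "x \<otimes>\<^bsub>C\<^esub> y = \<zero>\<^bsub>C\<^esub>" if "x \<in> J'" "y \<in> J'" for x y
      using ideal_prod.prod[of x J' y J' C] that assms by simp
  qed (use assms in auto)
  then interpret square_zero_bi_amalgamation A B C f g J J' .
  show ?thesis
    using assms total_ring_of_quotients_R local_ring_R total_ring_of_quotients_imp_prufer_ring
    by blast
qed

end
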